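(* Let $M\in\mathbb{N}$, $\delta,\varepsilon>0$, let $\mu$ be a distribution on $\{0,1\}^n\times\{0,1\}^n$ and let $f\colon\{0,1\}^n\times\{0,1\}^n\to\{0,1\}$ be such that $(f,\mu)$ has $(\varepsilon,\delta)$ relative-discrepancy. If $\Pi$ is a protocol with $I^{\mathrm{ext}}_{\mu}[\Pi]\le M$, then \[ \Pr_{(x,y)\sim\mu}[\mathrm{output}(\Pi(x,y))=f(x,y)]\le\frac12+2000\max\Big(\varepsilon,\frac{M}{\log(1/\delta)}\Big). \]
   Context: Protocols are two-party randomized communication protocols (Alice holds $x$, Bob holds $y$; output is a function of the transcript $\Pi(x,y)$). With $(X,Y)\sim\mu$, $I^{\mathrm{ext}}_\mu[\Pi]=I(\Pi(X,Y);X,Y)$ (base-2 logs). $(f,\mu)$ has $(\varepsilon,\delta)$ relative-discrepancy with respect to a distribution $\rho$ on $\{0,1\}^n\times\{0,1\}^n$ if for every rectangle $R=A\times B\subseteq\{0,1\}^n\times\{0,1\}^n$ with $\rho(R)\ge\delta$ we have $\mu(R\cap f^{-1}(0))\ge(\frac12-\varepsilon)\rho(R)$ and $\mu(R\cap f^{-1}(1))\ge(\frac12-\varepsilon)\rho(R)$; $(f,\mu)$ has $(\varepsilon,\delta)$ relative-discrepancy if this holds with respect to some distribution $\rho$.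
   Formalization: The formal theorem assumes in addition that δ < 1; for δ > 1 relative-discrepancy is vacuous and the claimed bound fails (e.g. constant f, small ε, M = 0), and for δ = 1 the quantity M/log(1/δ) is undefined. *)

theory Defs
  imports "HOL-Probability.Probability"
begin

definition cube :: "nat \<Rightarrow> bool list set" where
  "cube n = {x. length x = n}"

text \<open>Randomized two-party protocol trees. At an Alice node \<open>ANode p t0 t1\<close>, Alice
  (holding x) sends bit True with probability \<open>p x\<close> (clamped to [0,1] by bernoulli_pmf)
  and play continues in \<open>t1\<close>, otherwise she sends False and play continues in \<open>t0\<close>.
  Bob nodes are analogous with Bob's input y. A leaf carries the proto_output.
  The transcript is the sequence of bits sent.\<close>
datatype 'i proto =
    Leaf bool
  | ANode "'i \<Rightarrow> real" "'i proto" "'i proto"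
  | BNode "'i \<Rightarrow> real" "'i proto" "'i proto"

primrec transcript :: "'i proto \<Rightarrow> 'i \<Rightarrow> 'i \<Rightarrow> bool list pmf" where
  "transcript (Leaf b) x y = return_pmf []"
| "transcript (ANode p t0 t1) x y =
     bind_pmf (bernoulli_pmf (p x))
       (\<lambda>c. if c then map_pmf (Cons True) (transcript t1 x y)
            else map_pmf (Cons False) (transcript t0 x y))"
| "transcript (BNode p t0 t1) x y =
     bind_pmf (bernoulli_pmf (p y))
       (\<lambda>c. if c then map_pmf (Cons True) (transcript t1 x y)
            else map_pmf (Cons False) (transcript t0 x y))"

primrec proto_output :: "'i proto \<Rightarrow> bool list \<Rightarrow> bool" where
  "proto_output (Leaf b) t = b"
| "proto_output (ANode p t0 t1) t =
     (case t of [] \<Rightarrow> False | c # t' \<Rightarrow> (if c then proto_output t1 t' else proto_output t0 t'))"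
| "proto_output (BNode p t0 t1) t =
     (case t of [] \<Rightarrow> False | c # t' \<Rightarrow> (if c then proto_output t1 t' else proto_output t0 t'))"

definition joint :: "'i proto \<Rightarrow> ('i \<times> 'i) pmf \<Rightarrow> (bool list \<times> ('i \<times> 'i)) pmf" where
  "joint P mu = bind_pmf mu (\<lambda>(x, y). map_pmf (\<lambda>t. (t, (x, y))) (transcript P x y))"

definition mutual_info :: "('a \<times> 'b) pmf \<Rightarrow> real" where
  "mutual_info J = (\<Sum>z\<in>set_pmf J.
      pmf J z * log 2 (pmf J z / (pmf (map_pmf fst J) (fst z) * pmf (map_pmf snd J) (snd z))))"

definition ext_info :: "'i proto \<Rightarrow> ('i \<times> 'i) pmf \<Rightarrow> real" where
  "ext_info P mu = mutual_info (joint P mu)"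

definition rel_disc ::
  "nat \<Rightarrow> (bool list \<Rightarrow> bool list \<Rightarrow> bool) \<Rightarrow> (bool list \<times> bool list) pmf \<Rightarrow> real \<Rightarrow> real \<Rightarrow> bool" where
  "rel_disc n f mu eps delta \<longleftrightarrow>
     (\<exists>rho :: (bool list \<times> bool list) pmf. set_pmf rho \<subseteq> cube n \<times> cube n \<and>
        (\<forall>A B. A \<subseteq> cube n \<longrightarrow> B \<subseteq> cube n \<longrightarrow>
           measure_pmf.prob rho (A \<times> B) \<ge> delta \<longrightarrow>
             measure_pmf.prob mu ((A \<times> B) \<inter> {(x, y). \<not> f x y})
               \<ge> (1/2 - eps) * measure_pmf.prob rho (A \<times> B) \<and>
             measure_pmf.prob mu ((A \<times> B) \<inter> {(x, y). f x y})
               \<ge> (1/2 - eps) * measure_pmf.prob rho (A \<times> B)))"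

end

theory Submission
  imports Defs
begin

text \<open>
  Compare the protocol with the reference walk that, at every node, sends the next bit with its
  \<open>mu\<close>-average probability given the transcript. On a transcript, the likelihood ratio against the
  reference factors into a function of \<open>x\<close> and a function of \<open>y\<close>, and the external information is
  the expected logarithm of the product of these two ratios. Replace the protocol by a clipped one in
  which each player modifies the next bit just enough to keep the own ratio at most
  \<open>K\<close>, where \<open>K ^ 4 = 1 / \<delta>\<close>.

  The transcripts of the clipped protocol are fractional rectangles whose heights sum to at most
  \<open>K ^ 2\<close>. A bilinear form on a box is minimal at a vertex, so relative discrepancy extends from
  rectangles to fractional rectangles with an additive loss of \<open>\<delta>\<close> times the height; the clipped
  protocol therefore errs with probability at least \<open>(1/2 - \<epsilon>) (1 - \<delta> K ^ 2)\<close>. The original and the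
  clipped protocol differ only if a ratio exceeds \<open>K\<close> at some time, and by a maximal inequality this
  has probability \<open>O(M / log (1/\<delta>))\<close>. For \<open>M = 0\<close> the additive loss is not affordable, but then the
  transcript is independent of the input.
\<close>

subsection \<open>Protocol trees\<close>

definition clamp :: "real \<Rightarrow> real" where
  "clamp r = min 1 (max 0 r)"

lemma clamp_nonneg [simp]: "0 \<le> clamp r"
  and clamp_le_1 [simp]: "clamp r \<le> 1"
  by (auto simp: clamp_def)

lemma clamp_id: "0 \<le> r \<Longrightarrow> r \<le> 1 \<Longrightarrow> clamp r = r"
  by (simp add: clamp_def)

lemma bernoulli_pmf_clamp: "bernoulli_pmf r = bernoulli_pmf (clamp r)"
  by (rule pmf_eqI) (simp add: bernoulli_pmf.rep_eq clamp_def)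

lemma prob_eq_pmf_map: "measure_pmf.prob M S = pmf (map_pmf (\<lambda>x. x \<in> S) M) True"
  by (simp add: pmf_map vimage_def)

lemma prob_bind_bernoulli:
  "measure_pmf.prob (bind_pmf (bernoulli_pmf r) g) S
     = clamp r * measure_pmf.prob (g True) S + (1 - clamp r) * measure_pmf.prob (g False) S"
  by (simp add: bernoulli_pmf_clamp[of r] prob_eq_pmf_map map_bind_pmf pmf_bind mult.commute)

definition accept :: "'i proto \<Rightarrow> bool \<Rightarrow> 'i \<Rightarrow> 'i \<Rightarrow> real" where
  "accept P b x y = measure_pmf.prob (transcript P x y) {t. proto_output P t = b}"

lemma accept_nonneg [simp]: "0 \<le> accept P b x y"
  and accept_le_1 [simp]: "accept P b x y \<le> 1"
  by (simp_all add: accept_def)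

lemma accept_Leaf [simp]: "accept (Leaf b) c x y = of_bool (b = c)"
  by (simp add: accept_def)

lemma accept_ANode [simp]:
  "accept (ANode p t0 t1) c x y = clamp (p x) * accept t1 c x y + (1 - clamp (p x)) * accept t0 c x y"
  by (simp add: accept_def prob_bind_bernoulli vimage_def)

lemma accept_BNode [simp]:
  "accept (BNode p t0 t1) c x y = clamp (p y) * accept t1 c x y + (1 - clamp (p y)) * accept t0 c x y"
  by (simp add: accept_def prob_bind_bernoulli vimage_def)

lemma accept_Not: "accept P (\<not> c) x y = 1 - accept P c x y"
proof -
  have "{t. proto_output P t = (\<not> c)} = - {t. proto_output P t = c}" by auto
  then show ?thesis
    by (simp add: accept_def measure_pmf.prob_compl[of _ "transcript P x y", simplified] Compl_eq_Diff_UNIV)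
qed

subsection \<open>Pointwise divergence from the reference walk\<close>

text \<open>On a node of total weight 0 the division yields 0, so the bounds below hold there too;
  only \<open>one_minus_avg\<close> has to exclude this case.\<close>

definition avg :: "'z set \<Rightarrow> ('z \<Rightarrow> real) \<Rightarrow> ('z \<Rightarrow> real) \<Rightarrow> real" where
  "avg Z w q = (\<Sum>z\<in>Z. w z * q z) / (\<Sum>z\<in>Z. w z)"

lemma avg_bounds:
  assumes "\<And>z. z \<in> Z \<Longrightarrow> 0 \<le> w z" "\<And>z. z \<in> Z \<Longrightarrow> 0 \<le> q z" "\<And>z. z \<in> Z \<Longrightarrow> q z \<le> 1"
  shows "0 \<le> avg Z w q" "avg Z w q \<le> 1"
proof -
  have "0 \<le> (\<Sum>z\<in>Z. w z * q z)" "(\<Sum>z\<in>Z. w z * q z) \<le> (\<Sum>z\<in>Z. w z)"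
    using assms by (auto intro!: sum_nonneg sum_mono mult_left_le)
  then show "0 \<le> avg Z w q" "avg Z w q \<le> 1"
    by (auto simp: avg_def divide_le_eq_1)
qed

lemma sum_pos_of_mem:
  assumes "finite Z" "\<And>z. z \<in> Z \<Longrightarrow> 0 \<le> (h z :: real)" "z \<in> Z" "0 < h z"
  shows "0 < sum h Z"
  using assms by (meson sum_pos2)

lemma avg_pos:
  assumes "finite Z" "\<And>z. z \<in> Z \<Longrightarrow> 0 \<le> w z" "\<And>z. z \<in> Z \<Longrightarrow> 0 \<le> q z"
    and "z \<in> Z" "0 < w z" "0 < q z"
  shows "0 < avg Z w q"
  unfolding avg_def using assms by (intro divide_pos_pos sum_pos_of_mem[of Z _ z]) auto

lemma one_minus_avg:
  assumes "(\<Sum>z\<in>Z. w z) \<noteq> 0"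
  shows "1 - avg Z w q = avg Z w (\<lambda>z. 1 - q z)"
  using assms by (simp add: avg_def field_simps sum_subtractf)

lemma avg_less_1:
  assumes "finite Z" "\<And>z. z \<in> Z \<Longrightarrow> 0 \<le> w z" "\<And>z. z \<in> Z \<Longrightarrow> q z \<le> 1"
    and "z \<in> Z" "0 < w z" "q z < 1"
  shows "avg Z w q < 1"
proof -
  have "0 < (\<Sum>z\<in>Z. w z)" using assms by (intro sum_pos_of_mem[of Z _ z]) auto
  then show ?thesis
    using avg_pos[of Z w "\<lambda>z. 1 - q z" z] one_minus_avg[of w Z q] assms by simp
qed

text \<open>One recursion step shared by both players: \<open>k0\<close> and \<open>k1\<close> stand
  for the divergences of the two subtrees. A bit of probability 0 contributes 0 through its factor,
  whatever value the logarithm takes.\<close>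

definition kl_node where
  "kl_node Z q k0 k1 w z =
     q z * (ln (q z / avg Z w q) + k1 (\<lambda>z. w z * q z) z)
     + (1 - q z) * (ln ((1 - q z) / (1 - avg Z w q)) + k0 (\<lambda>z. w z * (1 - q z)) z)"

text \<open>The weight \<open>w z\<close> is \<open>mu z\<close> times the probability of reaching the current node on
  input \<open>z\<close>, so that \<open>avg Z w q\<close> is the probability that the next bit is \<open>True\<close> given the
  transcript so far. These bits make up the reference walk, and \<open>kl\<close> is the contribution of
  the single input \<open>z\<close> to the divergence of the true walk from it.\<close>

primrec kl :: "('i \<times> 'i) set \<Rightarrow> 'i proto \<Rightarrow> ('i \<times> 'i \<Rightarrow> real) \<Rightarrow> 'i \<times> 'i \<Rightarrow> real" where
  "kl Z (Leaf b) = (\<lambda>w z. 0)"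
| "kl Z (ANode p t0 t1) = kl_node Z (\<lambda>z. clamp (p (fst z))) (kl Z t0) (kl Z t1)"
| "kl Z (BNode p t0 t1) = kl_node Z (\<lambda>z. clamp (p (snd z))) (kl Z t0) (kl Z t1)"

text \<open>Nonnegative substitute for the logarithm of a likelihood ratio: along the true walk,
  \<open>ln L\<close> increases in expectation by the divergence of the step, while \<open>1 / L\<close> does not
  increase.\<close>

definition psi :: "real \<Rightarrow> real" where
  "psi L = ln L + 1 / L - 1"

lemma ln_ge_one_minus_inverse: "0 < (y::real) \<Longrightarrow> 1 - 1 / y \<le> ln y"
  using ln_le_minus_one[of "1 / y"] by (simp add: ln_div)

lemma psi_nonneg: "0 < L \<Longrightarrow> 0 \<le> psi L"
  using ln_ge_one_minus_inverse[of L] by (simp add: psi_def)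

text \<open>The derivative \<open>1 / L - 1 / L ^ 2\<close> is nonnegative from 1 on. In finite
  form, \<open>ln L - ln K\<close> is at least \<open>1 - K / L\<close>, and multiplying this by
  \<open>1 / K\<close>, which is at most 1, gives the drop of the reciprocal.\<close>

lemma psi_mono:
  assumes "1 \<le> K" "K \<le> L"
  shows "psi K \<le> psi L"
proof -
  have "1 - K / L \<le> ln L - ln K"
    using ln_ge_one_minus_inverse[of "L / K"] assms by (simp add: ln_div)
  moreover have "1 / K - 1 / L \<le> 1 - K / L"
  proof -
    have "(1 - K / L) * (1 / K) \<le> (1 - K / L) * 1"
      using assms by (intro mult_left_mono) auto
    then show ?thesis using assms by (simp add: field_simps)
  qed
  ultimately show ?thesis by (simp add: psi_def)
qed

text \<open>A single term of a divergence can be negative, but by no more than \<open>s - q\<close>;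
  these deficits cancel once both branches are added.\<close>

lemma branch_kl_ge:
  assumes "0 \<le> (q::real)" "0 < q \<Longrightarrow> 0 < s" "0 \<le> s"
  shows "q - s \<le> q * ln (q / s)"
proof (cases "q = 0")
  case False
  then have *: "0 < q" "0 < s" using assms by auto
  have "q - s = q * (1 - 1 / (q / s))"
    using * by (simp add: field_simps)
  also have "\<dots> \<le> q * ln (q / s)"
    using * by (intro mult_left_mono ln_ge_one_minus_inverse) auto
  finally show ?thesis .
qed (use assms in auto)

lemma branch_kl_eq:
  assumes "0 \<le> (q::real)" "0 < q \<Longrightarrow> 0 < s" "0 \<le> s" "q * ln (q / s) = q - s"
  shows "q = s"
proof (cases "q = 0")
  case False
  then have *: "0 < q" "0 < s" using assms by auto
  have "ln (s / q) = s / q - 1"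
    using assms(4) * by (simp add: ln_div field_simps)
  then have "s / q = 1" using * by (intro ln_eq_minus_one) auto
  then show ?thesis using * by simp
qed (use assms in auto)

text \<open>Gibbs' inequality at one node: the lower bounds \<open>q - s\<close> and
  \<open>(1 - q) - (1 - s)\<close> sum to 0. If the total vanishes, every summand is tight, which
  makes the bit probability equal to its average and passes vanishing divergence on to the reachable
  subtrees.\<close>

lemma kl_node_nonneg:
  assumes Z: "finite Z" "z \<in> Z" and w: "\<And>z. z \<in> Z \<Longrightarrow> 0 \<le> w z" "0 < w z"
    and q: "\<And>z. 0 \<le> q z" "\<And>z. q z \<le> 1"
    and k0: "q z < 1 \<Longrightarrow> 0 \<le> k0 (\<lambda>z. w z * (1 - q z)) z"
    and k1: "0 < q z \<Longrightarrow> 0 \<le> k1 (\<lambda>z. w z * q z) z"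
  shows "0 \<le> kl_node Z q k0 k1 w z"
    and "kl_node Z q k0 k1 w z = 0 \<Longrightarrow> q z = avg Z w q"
    and "kl_node Z q k0 k1 w z = 0 \<Longrightarrow> q z < 1 \<Longrightarrow> k0 (\<lambda>z. w z * (1 - q z)) z = 0"
    and "kl_node Z q k0 k1 w z = 0 \<Longrightarrow> 0 < q z \<Longrightarrow> k1 (\<lambda>z. w z * q z) z = 0"
proof -
  let ?s = "avg Z w q"
  let ?k1 = "k1 (\<lambda>z. w z * q z) z" and ?k0 = "k0 (\<lambda>z. w z * (1 - q z)) z"
  have s: "0 \<le> ?s" "?s \<le> 1" using avg_bounds[of Z w q] w q by auto
  have s1: "0 < q z \<Longrightarrow> 0 < ?s"
    using avg_pos[of Z w q z] Z w q by auto
  have s0: "0 < 1 - q z \<Longrightarrow> 0 < 1 - ?s"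
    using avg_less_1[of Z w q z] Z w q by auto
  have 1: "q z - ?s \<le> q z * ln (q z / ?s)"
    using branch_kl_ge s s1 q by blast
  have 0: "(1 - q z) - (1 - ?s) \<le> (1 - q z) * ln ((1 - q z) / (1 - ?s))"
    using branch_kl_ge[of "1 - q z" "1 - ?s"] s s0 q by auto
  have k: "0 \<le> q z * ?k1" "0 \<le> (1 - q z) * ?k0"
    using q[of z] k0 k1 by (cases "q z = 0"; simp; cases "q z = 1"; simp)+
  have eq: "kl_node Z q k0 k1 w z = q z * ln (q z / ?s) + (1 - q z) * ln ((1 - q z) / (1 - ?s))
      + q z * ?k1 + (1 - q z) * ?k0"
    by (simp add: kl_node_def algebra_simps)
  show "0 \<le> kl_node Z q k0 k1 w z" using 0 1 k eq by linarith
  assume z: "kl_node Z q k0 k1 w z = 0"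
  have "q z * ln (q z / ?s) = q z - ?s" using 0 1 k eq z by linarith
  then show "q z = ?s" using branch_kl_eq s s1 q by blast
  have "q z * ?k1 = 0" "(1 - q z) * ?k0 = 0" using 0 1 k eq z by linarith+
  then show "q z < 1 \<Longrightarrow> ?k0 = 0" "0 < q z \<Longrightarrow> ?k1 = 0" by auto
qed

lemma kl_nonneg:
  assumes "finite Z" "z \<in> Z" "\<And>z. z \<in> Z \<Longrightarrow> 0 \<le> w z" "0 < w z"
  shows "0 \<le> kl Z P w z"
  using assms(3,4)
proof (induction P arbitrary: w)
  case (ANode p t0 t1)
  then show ?case using assms(1,2) by (auto intro!: kl_node_nonneg(1))
next
  case (BNode p t0 t1)
  then show ?case using assms(1,2) by (auto intro!: kl_node_nonneg(1))
qed simp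

subsection \<open>Clipping\<close>

lemma linear_box:
  fixes h \<alpha> :: "'a \<Rightarrow> real"
  assumes "finite X" "\<And>x. x \<in> X \<Longrightarrow> 0 \<le> \<alpha> x" "\<And>x. x \<in> X \<Longrightarrow> \<alpha> x \<le> m"
  shows "m * (\<Sum>x\<in>{x\<in>X. h x < 0}. h x) \<le> (\<Sum>x\<in>X. h x * \<alpha> x)"
proof -
  have "m * (\<Sum>x\<in>{x\<in>X. h x < 0}. h x) = (\<Sum>x\<in>X. if h x < 0 then m * h x else 0)"
    using assms(1) by (auto simp: sum_distrib_left sum.inter_filter intro!: sum.cong)
  also have "\<dots> \<le> (\<Sum>x\<in>X. h x * \<alpha> x)"
    using assms(2,3) by (intro sum_mono) (auto simp: mult.commute mult_left_mono_neg)
  finally show ?thesis .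
qed

text \<open>Minimise in one variable at a time: for fixed \<open>\<beta>\<close> a minimising vertex
  in x is \<open>m\<close> times the indicator of \<open>A\<close>, and for that \<open>A\<close>
  one in y is \<open>m'\<close> times the indicator of \<open>B\<close>. What remains is a rectangle
  sum.\<close>

lemma bilinear_box:
  fixes g :: "'a \<Rightarrow> 'b \<Rightarrow> real"
  assumes fin: "finite X" "finite Y"
    and rect: "\<And>A B. A \<subseteq> X \<Longrightarrow> B \<subseteq> Y \<Longrightarrow> - d \<le> (\<Sum>x\<in>A. \<Sum>y\<in>B. g x y)"
    and \<alpha>: "\<And>x. x \<in> X \<Longrightarrow> 0 \<le> \<alpha> x" "\<And>x. x \<in> X \<Longrightarrow> \<alpha> x \<le> m" "0 \<le> m"
    and \<beta>: "\<And>y. y \<in> Y \<Longrightarrow> 0 \<le> \<beta> y" "\<And>y. y \<in> Y \<Longrightarrow> \<beta> y \<le> m'" "0 \<le> m'"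
  shows "- (d * m * m') \<le> (\<Sum>x\<in>X. \<Sum>y\<in>Y. g x y * \<alpha> x * \<beta> y)"
proof -
  define A where "A = {x \<in> X. (\<Sum>y\<in>Y. g x y * \<beta> y) < 0}"
  define B where "B = {y \<in> Y. (\<Sum>x\<in>A. g x y) < 0}"
  have "- (d * m * m') = m * (m' * (- d))" by simp
  also have "\<dots> \<le> m * (m' * (\<Sum>x\<in>A. \<Sum>y\<in>B. g x y))"
    using \<alpha>(3) \<beta>(3) by (intro mult_left_mono rect) (auto simp: A_def B_def)
  also have "\<dots> = m * (m' * (\<Sum>y\<in>B. \<Sum>x\<in>A. g x y))"
    by (subst sum.swap) simp
  also have "\<dots> \<le> m * (\<Sum>y\<in>Y. (\<Sum>x\<in>A. g x y) * \<beta> y)"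
    unfolding B_def using fin \<alpha>(3) \<beta> by (intro mult_left_mono linear_box) auto
  also have "\<dots> = m * (\<Sum>x\<in>A. \<Sum>y\<in>Y. g x y * \<beta> y)"
    by (subst sum.swap) (simp add: sum_distrib_right)
  also have "\<dots> \<le> (\<Sum>x\<in>X. (\<Sum>y\<in>Y. g x y * \<beta> y) * \<alpha> x)"
    unfolding A_def using fin \<alpha> by (intro linear_box) auto
  also have "\<dots> = (\<Sum>x\<in>X. \<Sum>y\<in>Y. g x y * \<alpha> x * \<beta> y)"
    unfolding sum_distrib_right by (simp add: mult_ac)
  finally show ?thesis .
qed

text \<open>One branch of the maximal inequality. \<open>B\<close> is the potential of the other
  player, \<open>k\<close> the divergence of the subtree, \<open>A\<close> the acceptance
  probability of the original subtree and \<open>g\<close> the weighted one of the clipped subtree.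
  Below the cap the claim is the induction hypothesis \<open>small\<close>; above it the potential
  alone pays for the loss.\<close>

lemma clip_branch:
  fixes a b :: real
  assumes pos: "0 < a" "0 < b" "0 < S" "1 \<le> K"
    and r: "0 \<le> r" "0 < r \<Longrightarrow> 0 < s" "0 \<le> s"
    and bnds: "0 \<le> B" "0 \<le> A" "A \<le> 1" "0 \<le> g"
    and small: "0 < r \<Longrightarrow> a * r \<le> K * (S * s) \<Longrightarrow>
      psi K * (a * r * b * A - g) \<le> a * r * b * (psi (a * r / (S * s)) + B + k)"
    and k: "0 < r \<Longrightarrow> 0 \<le> k"
  shows "psi K * (a * r * b * A - g)
    \<le> a * b * (r * (psi (a / S) + B + ln (r / s) + k) + (s - r) * (S / a))"
proof (cases "r = 0")
  case True
  have "psi K * (a * r * b * A - g) \<le> 0"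
    using True psi_nonneg[of K] pos bnds by (simp add: mult_nonneg_nonneg)
  also have "0 \<le> a * b * (r * (psi (a / S) + B + ln (r / s) + k) + (s - r) * (S / a))"
    using True pos r by simp
  finally show ?thesis .
next
  case False
  then have r': "0 < r" "0 < s" "0 \<le> k" using r k by auto
  \<comment> \<open>The logarithm gains \<open>ln (r / s)\<close>, while the reciprocal ratio leaves
    the correction \<open>(s - r) * (S / a)\<close>, which cancels against the sibling
    branch.\<close>
  have psi_eq: "r * psi (a * r / (S * s)) = r * (psi (a / S) + ln (r / s)) + (s - r) * (S / a)"
  proof -
    define u where "u = S / a"
    have "ln (a * r / (S * s)) = ln (a / S) + ln (r / s)"
      using pos r' by (simp add: ln_div ln_mult)
    moreover have "r * (1 / (a * r / (S * s))) = s * u"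
      using pos r' by (simp add: u_def field_simps)
    ultimately have "r * psi (a * r / (S * s)) = r * (ln (a / S) + ln (r / s) - 1) + s * u"
      unfolding psi_def by (simp only: right_diff_distrib distrib_left)
    also have "\<dots> = r * ((ln (a / S) + u - 1) + ln (r / s)) + (s - r) * u"
      by (simp add: algebra_simps)
    also have "ln (a / S) + u - 1 = psi (a / S)"
      by (simp add: psi_def u_def)
    finally show ?thesis by (simp only: u_def)
  qed
  have "psi K * (a * r * b * A - g) \<le> a * r * b * (psi (a * r / (S * s)) + B + k)"
  proof (cases "a * r \<le> K * (S * s)")
    \<comment> \<open>The branch is cut off. In the worst case all of its weight
      \<open>a * r * b\<close> is lost, and the new ratio is at least \<open>K\<close>, so its
      potential is at least \<open>psi K\<close>.\<close>
    case False
    then have "K \<le> a * r / (S * s)"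
      using pos r' by (simp add: pos_le_divide_eq)
    then have "psi K \<le> psi (a * r / (S * s))"
      using psi_mono pos by blast
    moreover have "a * r * b * A - g \<le> a * r * b * 1 - 0"
      using pos r' bnds by (intro diff_mono mult_left_mono) auto
    moreover have "0 \<le> psi K" using psi_nonneg[of K] pos by simp
    moreover have "0 \<le> a * r * b" using pos r' by simp
    ultimately have "psi K * (a * r * b * A - g) \<le> psi (a * r / (S * s)) * (a * r * b)"
      by (intro order_trans[OF mult_left_mono mult_right_mono]) auto
    also have "\<dots> \<le> a * r * b * (psi (a * r / (S * s)) + B + k)"
      using pos r' bnds by (subst mult.commute, intro mult_left_mono) auto
    finally show ?thesis .
  qed (use small r' in auto)
  also have "\<dots> = a * b * (r * psi (a * r / (S * s)) + r * (B + k))"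
    by (simp add: algebra_simps)
  also have "\<dots> = a * b * (r * (psi (a / S) + B + ln (r / s) + k) + (s - r) * (S / a))"
    unfolding psi_eq by (simp add: algebra_simps)
  finally show ?thesis .
qed

text \<open>Both branches are added. The reciprocal ratio has no drift under the true walk, so the
  corrections cancel and the potential grows exactly by the divergence of the step.\<close>

lemma clip_node:
  fixes a b :: real
  assumes pos: "0 < a" "0 < b" "0 < S" "1 \<le> K"
    and q: "0 \<le> q" "q \<le> 1" "0 < q \<Longrightarrow> 0 < s" "q < 1 \<Longrightarrow> s < 1" "0 \<le> s" "s \<le> 1"
    and bnds: "0 \<le> B" "0 \<le> A0" "A0 \<le> 1" "0 \<le> A1" "A1 \<le> 1" "0 \<le> g0" "0 \<le> g1"
    and small1: "0 < q \<Longrightarrow> a * q \<le> K * (S * s) \<Longrightarrow>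
      psi K * (a * q * b * A1 - g1) \<le> a * q * b * (psi (a * q / (S * s)) + B + k1)"
    and small0: "q < 1 \<Longrightarrow> a * (1 - q) \<le> K * (S * (1 - s)) \<Longrightarrow>
      psi K * (a * (1 - q) * b * A0 - g0) \<le> a * (1 - q) * b * (psi (a * (1 - q) / (S * (1 - s))) + B + k0)"
    and k: "0 < q \<Longrightarrow> 0 \<le> k1" "q < 1 \<Longrightarrow> 0 \<le> k0"
  shows "psi K * (a * b * (q * A1 + (1 - q) * A0) - (g1 + g0))
    \<le> a * b * (psi (a / S) + B + (q * (ln (q / s) + k1) + (1 - q) * (ln ((1 - q) / (1 - s)) + k0)))"
proof -
  have split: "a * b * (q * (l + B + l1 + k1) + (s - q) * u)
      + a * b * ((1 - q) * (l + B + l0 + k0) + ((1 - s) - (1 - q)) * u)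
      = a * b * (l + B + (q * (l1 + k1) + (1 - q) * (l0 + k0)))" for l l0 l1 u
    by (simp add: algebra_simps)
  have "psi K * (a * b * (q * A1 + (1 - q) * A0) - (g1 + g0))
      = psi K * (a * q * b * A1 - g1) + psi K * (a * (1 - q) * b * A0 - g0)"
    by (simp add: algebra_simps)
  also have "\<dots> \<le> a * b * (q * (psi (a / S) + B + ln (q / s) + k1) + (s - q) * (S / a))
      + a * b * ((1 - q) * (psi (a / S) + B + ln ((1 - q) / (1 - s)) + k0)
        + ((1 - s) - (1 - q)) * (S / a))"
    using assms by (intro add_mono clip_branch) auto
  also note split
  finally show ?thesis .
qed

text \<open>\<open>a\<close> is the true reach probability of a node, set to zero once it has exceeded \<open>K\<close> times
  the reference probability, and \<open>\<alpha>\<close> is the reach probability in the clipped protocol. The split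
  of \<open>\<alpha>\<close> is feasible because the two caps add up to \<open>K * S\<close>.\<close>

lemma clip_split:
  fixes a \<alpha> r :: "'i \<Rightarrow> real"
  assumes a: "\<And>x. x \<in> X \<Longrightarrow> 0 \<le> a x" "\<And>x. x \<in> X \<Longrightarrow> a x \<le> \<alpha> x" "\<And>x. x \<in> X \<Longrightarrow> \<alpha> x \<le> K * S"
    and r: "\<And>x. 0 \<le> r x" "\<And>x. r x \<le> 1"
    and s: "0 \<le> s" "s \<le> 1" and KS: "0 \<le> K" "0 \<le> S"
  obtains a0 a1 \<alpha>0 \<alpha>1 p' where
    "\<And>x. x \<in> X \<Longrightarrow> 0 \<le> a0 x" "\<And>x. x \<in> X \<Longrightarrow> a0 x \<le> \<alpha>0 x" "\<And>x. x \<in> X \<Longrightarrow> \<alpha>0 x \<le> K * (S * (1 - s))"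
    "\<And>x. x \<in> X \<Longrightarrow> 0 \<le> a1 x" "\<And>x. x \<in> X \<Longrightarrow> a1 x \<le> \<alpha>1 x" "\<And>x. x \<in> X \<Longrightarrow> \<alpha>1 x \<le> K * (S * s)"
    "\<And>x. a x * (1 - r x) \<le> K * (S * (1 - s)) \<Longrightarrow> a0 x = a x * (1 - r x)"
    "\<And>x. a x * r x \<le> K * (S * s) \<Longrightarrow> a1 x = a x * r x"
    "\<And>x. x \<in> X \<Longrightarrow> \<alpha> x * clamp (p' x) = \<alpha>1 x"
    "\<And>x. x \<in> X \<Longrightarrow> \<alpha> x * (1 - clamp (p' x)) = \<alpha>0 x"
proof -
  define a1 where "a1 x = (if a x * r x \<le> K * (S * s) then a x * r x else 0)" for x
  define a0 where "a0 x = (if a x * (1 - r x) \<le> K * (S * (1 - s)) then a x * (1 - r x) else 0)" for x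
  \<comment> \<open>The least value that dominates \<open>a1\<close> and leaves no more than the cap
    of the other branch. Where \<open>\<alpha>\<close> is 0 it is 0 as well, so the quotient used as
    bit probability is harmless there.\<close>
  define \<alpha>1 where "\<alpha>1 x = max (a1 x) (\<alpha> x - K * (S * (1 - s)))" for x
  have cap: "0 \<le> K * (S * s)" "0 \<le> K * (S * (1 - s))"
    using s KS by simp_all
  have cap_sum: "K * (S * s) + K * (S * (1 - s)) = K * S"
    by (simp add: algebra_simps)
  have nn: "0 \<le> a1 x" "0 \<le> a0 x" "a1 x + a0 x \<le> a x" if "x \<in> X" for x
  proof -
    have *: "0 \<le> a x * r x" "0 \<le> a x * (1 - r x)" "a x * r x + a x * (1 - r x) = a x"
      using a(1)[OF that] r[of x] by (auto simp flip: distrib_left)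
    show "0 \<le> a1 x" "0 \<le> a0 x" "a1 x + a0 x \<le> a x"
      using * by (auto simp: a1_def a0_def)
  qed
  have le: "a1 x \<le> K * (S * s)" "a0 x \<le> K * (S * (1 - s))" for x
    using cap by (auto simp: a1_def a0_def)
  have b1: "a1 x \<le> \<alpha>1 x" "\<alpha>1 x \<le> K * (S * s)" "a0 x \<le> \<alpha> x - \<alpha>1 x" "\<alpha> x - \<alpha>1 x \<le> K * (S * (1 - s))"
    if "x \<in> X" for x
    using nn[OF that] le[of x] a[OF that] cap_sum unfolding \<alpha>1_def by linarith+
  have cl: "\<alpha> x * clamp (\<alpha>1 x / \<alpha> x) = \<alpha>1 x" if "x \<in> X" for x
  proof (cases "\<alpha> x = 0")
    case True
    then have "\<alpha>1 x = 0" using b1[OF that] nn[OF that] by linarith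
    then show ?thesis using True by simp
  next
    case False
    then have "0 < \<alpha> x" using a[OF that] by linarith
    then show ?thesis
      using b1[OF that] nn[OF that] by (subst clamp_id) auto
  qed
  show thesis
  proof (rule that[of a0 "\<lambda>x. \<alpha> x - \<alpha>1 x" a1 \<alpha>1 "\<lambda>x. \<alpha>1 x / \<alpha> x"])
    show "\<alpha> x * (1 - clamp (\<alpha>1 x / \<alpha> x)) = \<alpha> x - \<alpha>1 x" if "x \<in> X" for x
      using cl[OF that] by (simp add: right_diff_distrib)
  qed (use nn b1 cl in \<open>auto simp: a0_def a1_def\<close>)
qed

text \<open>Relative discrepancy with the threshold turned into an additive loss, so that it holds
  for all rectangles at once and extends to fractional ones. In the application \<open>kappa\<close>
  is \<open>1/2 - eps\<close>.\<close>

locale rectangle_bound =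
  fixes X Y :: "'i set" and mu rho :: "'i \<Rightarrow> 'i \<Rightarrow> real" and f :: "'i \<Rightarrow> 'i \<Rightarrow> bool"
    and kappa delta K :: real
  assumes finite_X: "finite X" and finite_Y: "finite Y"
    and rectangle: "\<And>A B c. A \<subseteq> X \<Longrightarrow> B \<subseteq> Y \<Longrightarrow>
      kappa * ((\<Sum>x\<in>A. \<Sum>y\<in>B. rho x y) - delta) \<le> (\<Sum>x\<in>A. \<Sum>y\<in>B. mu x y * of_bool (f x y = c))"
    and K: "1 \<le> K"
begin

definition mass :: "('i \<Rightarrow> real) \<Rightarrow> ('i \<Rightarrow> real) \<Rightarrow> real" where
  "mass \<alpha> \<beta> = (\<Sum>x\<in>X. \<Sum>y\<in>Y. rho x y * \<alpha> x * \<beta> y)"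

definition error :: "('i \<Rightarrow> real) \<Rightarrow> ('i \<Rightarrow> real) \<Rightarrow> 'i proto \<Rightarrow> real" where
  "error \<alpha> \<beta> P = (\<Sum>x\<in>X. \<Sum>y\<in>Y. mu x y * \<alpha> x * \<beta> y * accept P (\<not> f x y) x y)"

text \<open>A leaf answers \<open>c\<close> on a whole fractional rectangle, so its error is the
  weight of the inputs with the other value. Its difference to \<open>kappa * mass\<close> is a
  bilinear form that is at least \<open>- kappa * delta\<close> on every rectangle.\<close>

lemma error_Leaf:
  assumes \<alpha>: "\<And>x. x \<in> X \<Longrightarrow> 0 \<le> \<alpha> x" "\<And>x. x \<in> X \<Longrightarrow> \<alpha> x \<le> m" "0 \<le> m"
    and \<beta>: "\<And>y. y \<in> Y \<Longrightarrow> 0 \<le> \<beta> y" "\<And>y. y \<in> Y \<Longrightarrow> \<beta> y \<le> m'" "0 \<le> m'"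
  shows "kappa * (mass \<alpha> \<beta> - delta * m * m') \<le> error \<alpha> \<beta> (Leaf c)"
proof -
  define g where "g x y = mu x y * of_bool (f x y = (\<not> c)) - kappa * rho x y" for x y
  have "- (kappa * delta * m * m') \<le> (\<Sum>x\<in>X. \<Sum>y\<in>Y. g x y * \<alpha> x * \<beta> y)"
  proof (rule bilinear_box[OF finite_X finite_Y _ \<alpha> \<beta>])
    fix A B assume "A \<subseteq> X" "B \<subseteq> Y"
    from rectangle[OF this, of "\<not> c"] show "- (kappa * delta) \<le> (\<Sum>x\<in>A. \<Sum>y\<in>B. g x y)"
      by (simp add: g_def sum_subtractf sum_distrib_left algebra_simps)
  qed
  also have "(\<Sum>x\<in>X. \<Sum>y\<in>Y. g x y * \<alpha> x * \<beta> y) = error \<alpha> \<beta> (Leaf c) - kappa * mass \<alpha> \<beta>"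
    unfolding error_def mass_def g_def sum_distrib_left sum_subtractf[symmetric]
    by (intro sum.cong refl) (auto simp: algebra_simps)
  finally show ?thesis by (simp add: algebra_simps)
qed

text \<open>\<open>S\<close> and \<open>T\<close> are the products of the reference probabilities over the Alice nodes and
  over the Bob nodes of the path to the current node.\<close>

definition clipped where
  "clipped w a b \<alpha> \<beta> S T P P' \<longleftrightarrow>
     kappa * (mass \<alpha> \<beta> - delta * (K * S) * (K * T)) \<le> error \<alpha> \<beta> P' \<and>
     (\<forall>x\<in>X. \<forall>y\<in>Y. 0 < w (x, y) \<longrightarrow> 0 < a x \<longrightarrow> 0 < b y \<longrightarrow> (\<forall>c.
        psi K * (a x * b y * accept P c x y - \<alpha> x * \<beta> y * accept P' c x y)
        \<le> a x * b y * (psi (a x / S) + psi (b y / T) + kl (X \<times> Y) P w (x, y))))"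

lemma clippedD:
  assumes "clipped w a b \<alpha> \<beta> S T P P'" "x \<in> X" "y \<in> Y" "0 < w (x, y)" "0 < a x" "0 < b y"
  shows "psi K * (a x * b y * accept P c x y - \<alpha> x * \<beta> y * accept P' c x y)
    \<le> a x * b y * (psi (a x / S) + psi (b y / T) + kl (X \<times> Y) P w (x, y))"
  using assms by (simp add: clipped_def)

text \<open>Induction on the tree. The first half of \<open>clipped\<close> adds up over the
  children because the caps do; the second half, the maximal inequality for each input, is
  \<open>clip_node\<close>. Only the data of the speaking player change: \<open>a\<close>,
  \<open>\<alpha>\<close>, \<open>S\<close> at Alice nodes and \<open>b\<close>,
  \<open>\<beta>\<close>, \<open>T\<close> at Bob nodes.\<close>

lemma ex_clipped:
  assumes "\<And>z. z \<in> X \<times> Y \<Longrightarrow> 0 \<le> w z"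
    and "\<And>x. x \<in> X \<Longrightarrow> 0 \<le> a x" "\<And>x. x \<in> X \<Longrightarrow> a x \<le> \<alpha> x" "\<And>x. x \<in> X \<Longrightarrow> \<alpha> x \<le> K * S"
    and "\<And>y. y \<in> Y \<Longrightarrow> 0 \<le> b y" "\<And>y. y \<in> Y \<Longrightarrow> b y \<le> \<beta> y" "\<And>y. y \<in> Y \<Longrightarrow> \<beta> y \<le> K * T"
    and "0 \<le> S" "0 \<le> T"
  shows "\<exists>P'. clipped w a b \<alpha> \<beta> S T P P'"
  using assms
proof (induction P arbitrary: w a b \<alpha> \<beta> S T)
  case (Leaf c)
  \<comment> \<open>Since \<open>a x\<close> is at most \<open>K * S\<close>, a positive reach
    weight forces a positive reference probability.\<close>
  have pos: "0 < S" if "x \<in> X" "0 < a x" for x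
    using Leaf.prems(3,4)[of x] Leaf.prems(8) that K by (cases "S = 0") force+
  have pos': "0 < T" if "y \<in> Y" "0 < b y" for y
    using Leaf.prems(6,7)[of y] Leaf.prems(9) that K by (cases "T = 0") force+
  have nonneg: "\<And>x. x \<in> X \<Longrightarrow> 0 \<le> \<alpha> x" "\<And>y. y \<in> Y \<Longrightarrow> 0 \<le> \<beta> y"
    using order_trans[OF Leaf.prems(2,3)] order_trans[OF Leaf.prems(5,6)] by blast+
  have "kappa * (mass \<alpha> \<beta> - delta * (K * S) * (K * T)) \<le> error \<alpha> \<beta> (Leaf c)"
    using Leaf.prems K nonneg by (intro error_Leaf) auto
  moreover have "psi K * (a x * b y * d - \<alpha> x * \<beta> y * d) \<le> a x * b y * (psi (a x / S) + psi (b y / T))"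
    if "x \<in> X" "y \<in> Y" "0 < a x" "0 < b y" "0 \<le> d" for x y d
  proof -
    \<comment> \<open>At a leaf the clipped weights dominate, so nothing is lost and the left side
      is nonpositive.\<close>
    have "a x * b y \<le> \<alpha> x * \<beta> y"
      using Leaf.prems that nonneg by (intro mult_mono) auto
    then have "psi K * ((a x * b y - \<alpha> x * \<beta> y) * d) \<le> 0"
      using psi_nonneg[of K] K that by (intro mult_nonneg_nonpos mult_nonpos_nonneg) auto
    also have "0 \<le> a x * b y * (psi (a x / S) + psi (b y / T))"
      using that pos pos' by (intro mult_nonneg_nonneg add_nonneg_nonneg psi_nonneg) auto
    finally show ?thesis by (simp add: left_diff_distrib)
  qed
  ultimately have "clipped w a b \<alpha> \<beta> S T (Leaf c) (Leaf c)"
    by (auto simp: clipped_def)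
  then show ?case by blast
next
  case (ANode p t0 t1)
  let ?Z = "X \<times> Y"
  define q where "q = (\<lambda>z::'i \<times> 'i. clamp (p (fst z)))"
  define s where "s = avg ?Z w q"
  define w1 where "w1 = (\<lambda>z. w z * q z)"
  define w0 where "w0 = (\<lambda>z. w z * (1 - q z))"
  have fin: "finite ?Z" using finite_X finite_Y by simp
  have s: "0 \<le> s" "s \<le> 1"
    unfolding s_def using ANode.prems(1) by (auto intro!: avg_bounds simp: q_def)
  obtain a0 a1 \<alpha>0 \<alpha>1 p' where sp:
    "\<And>x. x \<in> X \<Longrightarrow> 0 \<le> a0 x" "\<And>x. x \<in> X \<Longrightarrow> a0 x \<le> \<alpha>0 x" "\<And>x. x \<in> X \<Longrightarrow> \<alpha>0 x \<le> K * (S * (1 - s))"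
    "\<And>x. x \<in> X \<Longrightarrow> 0 \<le> a1 x" "\<And>x. x \<in> X \<Longrightarrow> a1 x \<le> \<alpha>1 x" "\<And>x. x \<in> X \<Longrightarrow> \<alpha>1 x \<le> K * (S * s)"
    "\<And>x. a x * (1 - clamp (p x)) \<le> K * (S * (1 - s)) \<Longrightarrow> a0 x = a x * (1 - clamp (p x))"
    "\<And>x. a x * clamp (p x) \<le> K * (S * s) \<Longrightarrow> a1 x = a x * clamp (p x)"
    "\<And>x. x \<in> X \<Longrightarrow> \<alpha> x * clamp (p' x) = \<alpha>1 x"
    "\<And>x. x \<in> X \<Longrightarrow> \<alpha> x * (1 - clamp (p' x)) = \<alpha>0 x"
    by (rule clip_split[of X a \<alpha> K S "\<lambda>x. clamp (p x)" s];
        ((rule that; assumption) | use ANode.prems(2-4,8) s K in simp))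
  have "\<exists>P0. clipped w0 a0 b \<alpha>0 \<beta> (S * (1 - s)) T t0 P0"
    by (rule ANode.IH(1)) (use sp ANode.prems s in \<open>auto simp: w0_def q_def\<close>)
  then obtain P0 where P0: "clipped w0 a0 b \<alpha>0 \<beta> (S * (1 - s)) T t0 P0" ..
  have "\<exists>P1. clipped w1 a1 b \<alpha>1 \<beta> (S * s) T t1 P1"
    by (rule ANode.IH(2)) (use sp ANode.prems s in \<open>auto simp: w1_def q_def\<close>)
  then obtain P1 where P1: "clipped w1 a1 b \<alpha>1 \<beta> (S * s) T t1 P1" ..
  \<comment> \<open>Both functionals are linear in \<open>\<alpha>\<close>, and the permitted losses
    add up because \<open>S * s + S * (1 - s) = S\<close>.\<close>
  have "mass \<alpha> \<beta> = mass \<alpha>1 \<beta> + mass \<alpha>0 \<beta>"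
    unfolding mass_def sum.distrib[symmetric]
    by (intro sum.cong refl) (simp add: sp(9,10)[symmetric] algebra_simps)
  moreover have "error \<alpha> \<beta> (ANode p' P0 P1) = error \<alpha>1 \<beta> P1 + error \<alpha>0 \<beta> P0"
    unfolding error_def sum.distrib[symmetric]
    by (intro sum.cong refl) (simp add: sp(9,10)[symmetric] algebra_simps)
  moreover have "kappa * (mass \<alpha>1 \<beta> - delta * (K * (S * s)) * (K * T)) \<le> error \<alpha>1 \<beta> P1"
      "kappa * (mass \<alpha>0 \<beta> - delta * (K * (S * (1 - s))) * (K * T)) \<le> error \<alpha>0 \<beta> P0"
    using P0 P1 by (auto simp: clipped_def)
  ultimately have err: "kappa * (mass \<alpha> \<beta> - delta * (K * S) * (K * T)) \<le> error \<alpha> \<beta> (ANode p' P0 P1)"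
    by (simp add: algebra_simps)
  have "psi K * (a x * b y * accept (ANode p t0 t1) c x y - \<alpha> x * \<beta> y * accept (ANode p' P0 P1) c x y)
        \<le> a x * b y * (psi (a x / S) + psi (b y / T) + kl ?Z (ANode p t0 t1) w (x, y))"
    if xy: "x \<in> X" "y \<in> Y" and wp: "0 < w (x, y)" and ab: "0 < a x" "0 < b y" for x y c
  proof -
    have S: "0 < S" using ANode.prems(3,4)[of x] ANode.prems(8) xy ab K by (cases "S = 0") force+
    have T: "0 < T" using ANode.prems(6,7)[of y] ANode.prems(9) xy ab K by (cases "T = 0") force+
    have "psi K * (a x * b y * (q (x,y) * accept t1 c x y + (1 - q (x,y)) * accept t0 c x y)
        - (\<alpha>1 x * \<beta> y * accept P1 c x y + \<alpha>0 x * \<beta> y * accept P0 c x y))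
        \<le> a x * b y * (psi (a x / S) + psi (b y / T)
          + (q (x,y) * (ln (q (x,y) / s) + kl ?Z t1 w1 (x,y))
           + (1 - q (x,y)) * (ln ((1 - q (x,y)) / (1 - s)) + kl ?Z t0 w0 (x,y))))"
    proof (rule clip_node[OF ab S K])
      show "0 < q (x,y) \<Longrightarrow> 0 < s"
        unfolding s_def using avg_pos[OF fin, of w q "(x,y)"] ANode.prems(1) xy wp by (auto simp: q_def)
      show "q (x,y) < 1 \<Longrightarrow> s < 1"
        unfolding s_def using avg_less_1[OF fin, of w q "(x,y)"] ANode.prems(1) xy wp by (auto simp: q_def)
      show "0 < q (x,y) \<Longrightarrow> 0 \<le> kl ?Z t1 w1 (x,y)" "q (x,y) < 1 \<Longrightarrow> 0 \<le> kl ?Z t0 w0 (x,y)"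
        using ANode.prems(1) xy wp fin by (auto intro!: kl_nonneg simp: w1_def w0_def q_def)
      show "psi K * (a x * q (x,y) * b y * accept t1 c x y - \<alpha>1 x * \<beta> y * accept P1 c x y)
          \<le> a x * q (x,y) * b y * (psi (a x * q (x,y) / (S * s)) + psi (b y / T) + kl ?Z t1 w1 (x,y))"
        if "0 < q (x,y)" "a x * q (x,y) \<le> K * (S * s)"
        using P1 that sp(8)[of x] xy wp ab unfolding clipped_def by (auto simp: w1_def q_def)
      show "psi K * (a x * (1 - q (x,y)) * b y * accept t0 c x y - \<alpha>0 x * \<beta> y * accept P0 c x y)
          \<le> a x * (1 - q (x,y)) * b y * (psi (a x * (1 - q (x,y)) / (S * (1 - s))) + psi (b y / T) + kl ?Z t0 w0 (x,y))"
        if "q (x,y) < 1" "a x * (1 - q (x,y)) \<le> K * (S * (1 - s))"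
        using P0 that sp(7)[of x] xy wp ab unfolding clipped_def by (auto simp: w0_def q_def)
      show "0 \<le> \<alpha>1 x * \<beta> y * accept P1 c x y" "0 \<le> \<alpha>0 x * \<beta> y * accept P0 c x y"
        using sp(1,2,4,5)[OF xy(1)] ANode.prems(5,6)[OF xy(2)]
        by (auto intro!: mult_nonneg_nonneg intro: order_trans)
      show "0 \<le> psi (b y / T)" using ab T by (simp add: psi_nonneg)
    qed (use s in \<open>auto simp: q_def\<close>)
    moreover have "\<alpha> x * \<beta> y * accept (ANode p' P0 P1) c x y
        = \<alpha>1 x * \<beta> y * accept P1 c x y + \<alpha>0 x * \<beta> y * accept P0 c x y"
      by (simp add: sp(9,10)[OF xy(1), symmetric] algebra_simps)
    ultimately show ?thesis
      by (simp add: kl_node_def q_def s_def w0_def w1_def)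
  qed
  then have "clipped w a b \<alpha> \<beta> S T (ANode p t0 t1) (ANode p' P0 P1)"
    using err by (simp only: clipped_def) blast
  then show ?case by blast
next
  case (BNode p t0 t1)
  let ?Z = "X \<times> Y"
  define q where "q = (\<lambda>z::'i \<times> 'i. clamp (p (snd z)))"
  define s where "s = avg ?Z w q"
  define w1 where "w1 = (\<lambda>z. w z * q z)"
  define w0 where "w0 = (\<lambda>z. w z * (1 - q z))"
  have fin: "finite ?Z" using finite_X finite_Y by simp
  have s: "0 \<le> s" "s \<le> 1"
    unfolding s_def using BNode.prems(1) by (auto intro!: avg_bounds simp: q_def)
  obtain b0 b1 \<beta>0 \<beta>1 p' where sp:
    "\<And>y. y \<in> Y \<Longrightarrow> 0 \<le> b0 y" "\<And>y. y \<in> Y \<Longrightarrow> b0 y \<le> \<beta>0 y" "\<And>y. y \<in> Y \<Longrightarrow> \<beta>0 y \<le> K * (T * (1 - s))"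
    "\<And>y. y \<in> Y \<Longrightarrow> 0 \<le> b1 y" "\<And>y. y \<in> Y \<Longrightarrow> b1 y \<le> \<beta>1 y" "\<And>y. y \<in> Y \<Longrightarrow> \<beta>1 y \<le> K * (T * s)"
    "\<And>y. b y * (1 - clamp (p y)) \<le> K * (T * (1 - s)) \<Longrightarrow> b0 y = b y * (1 - clamp (p y))"
    "\<And>y. b y * clamp (p y) \<le> K * (T * s) \<Longrightarrow> b1 y = b y * clamp (p y)"
    "\<And>y. y \<in> Y \<Longrightarrow> \<beta> y * clamp (p' y) = \<beta>1 y"
    "\<And>y. y \<in> Y \<Longrightarrow> \<beta> y * (1 - clamp (p' y)) = \<beta>0 y"
    by (rule clip_split[of Y b \<beta> K T "\<lambda>y. clamp (p y)" s];
        ((rule that; assumption) | use BNode.prems(5-7,9) s K in simp))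
  have "\<exists>P0. clipped w0 a b0 \<alpha> \<beta>0 S (T * (1 - s)) t0 P0"
    by (rule BNode.IH(1)) (use sp BNode.prems s in \<open>auto simp: w0_def q_def\<close>)
  then obtain P0 where P0: "clipped w0 a b0 \<alpha> \<beta>0 S (T * (1 - s)) t0 P0" ..
  have "\<exists>P1. clipped w1 a b1 \<alpha> \<beta>1 S (T * s) t1 P1"
    by (rule BNode.IH(2)) (use sp BNode.prems s in \<open>auto simp: w1_def q_def\<close>)
  then obtain P1 where P1: "clipped w1 a b1 \<alpha> \<beta>1 S (T * s) t1 P1" ..
  have "mass \<alpha> \<beta> = mass \<alpha> \<beta>1 + mass \<alpha> \<beta>0"
    unfolding mass_def sum.distrib[symmetric]
    by (intro sum.cong refl) (simp add: sp(9,10)[symmetric] algebra_simps)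
  moreover have "error \<alpha> \<beta> (BNode p' P0 P1) = error \<alpha> \<beta>1 P1 + error \<alpha> \<beta>0 P0"
    unfolding error_def sum.distrib[symmetric]
    by (intro sum.cong refl) (simp add: sp(9,10)[symmetric] algebra_simps)
  moreover have "kappa * (mass \<alpha> \<beta>1 - delta * (K * S) * (K * (T * s))) \<le> error \<alpha> \<beta>1 P1"
      "kappa * (mass \<alpha> \<beta>0 - delta * (K * S) * (K * (T * (1 - s)))) \<le> error \<alpha> \<beta>0 P0"
    using P0 P1 by (auto simp: clipped_def)
  ultimately have err: "kappa * (mass \<alpha> \<beta> - delta * (K * S) * (K * T)) \<le> error \<alpha> \<beta> (BNode p' P0 P1)"
    by (simp add: algebra_simps)
  have "psi K * (a x * b y * accept (BNode p t0 t1) c x y - \<alpha> x * \<beta> y * accept (BNode p' P0 P1) c x y)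
        \<le> a x * b y * (psi (a x / S) + psi (b y / T) + kl ?Z (BNode p t0 t1) w (x, y))"
    if xy: "x \<in> X" "y \<in> Y" and wp: "0 < w (x, y)" and ab: "0 < a x" "0 < b y" for x y c
  proof -
    have S: "0 < S" using BNode.prems(3,4)[of x] BNode.prems(8) xy ab K by (cases "S = 0") force+
    have T: "0 < T" using BNode.prems(6,7)[of y] BNode.prems(9) xy ab K by (cases "T = 0") force+
    \<comment> \<open>The one-step inequality is applied with the players exchanged, hence the
      commuted products.\<close>
    have "psi K * (b y * a x * (q (x,y) * accept t1 c x y + (1 - q (x,y)) * accept t0 c x y)
        - (\<alpha> x * \<beta>1 y * accept P1 c x y + \<alpha> x * \<beta>0 y * accept P0 c x y))
        \<le> b y * a x * (psi (b y / T) + psi (a x / S)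
          + (q (x,y) * (ln (q (x,y) / s) + kl ?Z t1 w1 (x,y))
           + (1 - q (x,y)) * (ln ((1 - q (x,y)) / (1 - s)) + kl ?Z t0 w0 (x,y))))"
    proof (rule clip_node[OF ab(2,1) T K])
      show "0 < q (x,y) \<Longrightarrow> 0 < s"
        unfolding s_def using avg_pos[OF fin, of w q "(x,y)"] BNode.prems(1) xy wp by (auto simp: q_def)
      show "q (x,y) < 1 \<Longrightarrow> s < 1"
        unfolding s_def using avg_less_1[OF fin, of w q "(x,y)"] BNode.prems(1) xy wp by (auto simp: q_def)
      show "0 < q (x,y) \<Longrightarrow> 0 \<le> kl ?Z t1 w1 (x,y)" "q (x,y) < 1 \<Longrightarrow> 0 \<le> kl ?Z t0 w0 (x,y)"
        using BNode.prems(1) xy wp fin by (auto intro!: kl_nonneg simp: w1_def w0_def q_def)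
      show "psi K * (b y * q (x,y) * a x * accept t1 c x y - \<alpha> x * \<beta>1 y * accept P1 c x y)
          \<le> b y * q (x,y) * a x * (psi (b y * q (x,y) / (T * s)) + psi (a x / S) + kl ?Z t1 w1 (x,y))"
        if "0 < q (x,y)" "b y * q (x,y) \<le> K * (T * s)"
        proof -
        have b1: "b1 y = b y * q (x,y)" using sp(8)[of y] that by (simp add: q_def)
        have "0 < b1 y" "0 < w1 (x, y)" using that wp ab by (simp_all add: b1 w1_def)
        from clippedD[OF P1 xy this(2) ab(1) this(1), of c] show ?thesis
          unfolding b1 by (simp only: mult_ac add_ac)
      qed
      show "psi K * (b y * (1 - q (x,y)) * a x * accept t0 c x y - \<alpha> x * \<beta>0 y * accept P0 c x y)
          \<le> b y * (1 - q (x,y)) * a x * (psi (b y * (1 - q (x,y)) / (T * (1 - s))) + psi (a x / S) + kl ?Z t0 w0 (x,y))"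
        if "q (x,y) < 1" "b y * (1 - q (x,y)) \<le> K * (T * (1 - s))"
        proof -
        have b0: "b0 y = b y * (1 - q (x,y))" using sp(7)[of y] that by (simp add: q_def)
        have "0 < b0 y" "0 < w0 (x, y)" using that wp ab by (simp_all add: b0 w0_def)
        from clippedD[OF P0 xy this(2) ab(1) this(1), of c] show ?thesis
          unfolding b0 by (simp only: mult_ac add_ac)
      qed
      show "0 \<le> \<alpha> x * \<beta>1 y * accept P1 c x y" "0 \<le> \<alpha> x * \<beta>0 y * accept P0 c x y"
        using sp(1,2,4,5)[OF xy(2)] BNode.prems(2,3)[OF xy(1)]
        by (auto intro!: mult_nonneg_nonneg intro: order_trans)
      show "0 \<le> psi (a x / S)" using ab S by (simp add: psi_nonneg)
    qed (use s in \<open>auto simp: q_def\<close>)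
    moreover have "\<alpha> x * \<beta> y * accept (BNode p' P0 P1) c x y
        = \<alpha> x * \<beta>1 y * accept P1 c x y + \<alpha> x * \<beta>0 y * accept P0 c x y"
      by (simp add: sp(9,10)[OF xy(2), symmetric] algebra_simps)
    moreover have "psi (b y / T) + psi (a x / S) = psi (a x / S) + psi (b y / T)" "b y * a x = a x * b y"
      by simp_all
    ultimately show ?thesis
      by (simp add: kl_node_def q_def s_def w0_def w1_def)
  qed
  then have "clipped w a b \<alpha> \<beta> S T (BNode p t0 t1) (BNode p' P0 P1)"
    using err by (simp only: clipped_def) blast
  then show ?case by blast
qed

end

subsection \<open>The chain rule for external information\<close>

abbreviation trans_prob :: "'i proto \<Rightarrow> 'i \<times> 'i \<Rightarrow> bool list \<Rightarrow> real" where
  "trans_prob P z t \<equiv> pmf (transcript P (fst z) (snd z)) t"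

text \<open>A finite set containing the support for every input, so that all transcript sums share
  one index set.\<close>

primrec paths :: "'i proto \<Rightarrow> bool list set" where
  "paths (Leaf b) = {[]}"
| "paths (ANode p t0 t1) = Cons True ` paths t1 \<union> Cons False ` paths t0"
| "paths (BNode p t0 t1) = Cons True ` paths t1 \<union> Cons False ` paths t0"

lemma finite_paths [simp]: "finite (paths P)"
  by (induction P) auto

lemma set_transcript: "set_pmf (transcript P x y) \<subseteq> paths P"
proof (induction P)
  case (ANode p t0 t1)
  then show ?case by (fastforce split: if_splits)
next
  case (BNode p t0 t1)
  then show ?case by (fastforce split: if_splits)
qed simp

lemma sum_trans_prob: "(\<Sum>t\<in>paths P. trans_prob P z t) = 1"
  using sum_pmf_eq_1[OF finite_paths set_transcript] .

lemma pmf_bind_bernoulli_Cons: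
  "pmf (bind_pmf (bernoulli_pmf r) (\<lambda>c. if c then map_pmf (Cons True) M1 else map_pmf (Cons False) M0)) (c # t)
     = (if c then clamp r * pmf M1 t else (1 - clamp r) * pmf M0 t)"
proof -
  have "pmf (map_pmf (Cons d) M) (c # t) = (if d = c then pmf M t else 0)" for d M
    by (auto simp: pmf_map_inj' pmf_eq_0_set_pmf)
  then show ?thesis
    by (simp add: bernoulli_pmf_clamp[of r] pmf_bind mult.commute)
qed

lemma sum_paths_node:
  "(\<Sum>t\<in>Cons True ` paths t1 \<union> Cons False ` paths t0. h t)
     = (\<Sum>t\<in>paths t1. h (True # t)) + (\<Sum>t\<in>paths t0. h (False # t))"
  by (subst sum.union_disjoint) (auto simp: sum.reindex)

text \<open>The ratio inside the logarithm factors into \<open>r z / avg Z w r\<close> and the same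
  ratio for the subtree with weights \<open>w z * r z\<close>. The first factor does not depend on
  \<open>t\<close>, and the \<open>\<tau> z t\<close> sum to 1.\<close>

lemma branch_chain:
  assumes Z: "finite Z" "z \<in> Z" and w: "\<And>z. z \<in> Z \<Longrightarrow> 0 \<le> w z" "0 < w z"
    and r: "\<And>z. z \<in> Z \<Longrightarrow> 0 \<le> (r z :: real)"
    and tau: "\<And>z t. 0 \<le> (\<tau> z t :: real)" "(\<Sum>t\<in>T. \<tau> z t) = 1"
  shows "(\<Sum>t\<in>T. (r z * \<tau> z t) * ln ((r z * \<tau> z t) * (\<Sum>z\<in>Z. w z) / (\<Sum>z\<in>Z. w z * (r z * \<tau> z t))))
    = r z * (ln (r z / avg Z w r)
       + (\<Sum>t\<in>T. \<tau> z t * ln (\<tau> z t * (\<Sum>z\<in>Z. w z * r z) / (\<Sum>z\<in>Z. w z * r z * \<tau> z t))))"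
proof (cases "r z = 0")
  case False
  then have r': "0 < r z" using r Z by force
  let ?W = "\<Sum>z\<in>Z. w z" and ?V = "\<Sum>z\<in>Z. w z * r z"
  have W: "0 < ?W" using sum_pos_of_mem[of Z w z] Z w by auto
  have V: "0 < ?V" using sum_pos_of_mem[of Z "\<lambda>z. w z * r z" z] Z w r r' by auto
  have "(r z * \<tau> z t) * ln ((r z * \<tau> z t) * ?W / (\<Sum>z\<in>Z. w z * (r z * \<tau> z t)))
     = r z * (\<tau> z t * ln (r z / avg Z w r) + \<tau> z t * ln (\<tau> z t * ?V / (\<Sum>z\<in>Z. w z * r z * \<tau> z t)))" for t
  proof (cases "\<tau> z t = 0")
    case False
    then have t: "0 < \<tau> z t" using tau(1)[of z t] by simp
    have "0 < (\<Sum>z\<in>Z. w z * r z * \<tau> z t)"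
      using sum_pos_of_mem[of Z "\<lambda>z. w z * r z * \<tau> z t" z] Z w r r' t tau by auto
    then show ?thesis
      using W V t r' by (simp add: avg_def ln_div ln_mult mult.assoc algebra_simps)
  qed simp
  then have "(\<Sum>t\<in>T. (r z * \<tau> z t) * ln ((r z * \<tau> z t) * ?W / (\<Sum>z\<in>Z. w z * (r z * \<tau> z t))))
     = r z * ((\<Sum>t\<in>T. \<tau> z t) * ln (r z / avg Z w r)
        + (\<Sum>t\<in>T. \<tau> z t * ln (\<tau> z t * ?V / (\<Sum>z\<in>Z. w z * r z * \<tau> z t))))"
    by (simp add: sum_distrib_left sum_distrib_right sum.distrib distrib_left)
  then show ?thesis using tau(2) by simp
qed simp

lemma kl_node_chain:
  assumes Z: "finite Z" "z \<in> Z" and w: "\<And>z. z \<in> Z \<Longrightarrow> 0 \<le> w z" "0 < w z"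
    and q: "\<And>z. 0 \<le> q z" "\<And>z. q z \<le> 1"
    and T: "T = Cons True ` paths t1 \<union> Cons False ` paths t0"
    and \<tau>: "\<And>z t. \<tau> z (True # t) = q z * trans_prob t1 z t"
      "\<And>z t. \<tau> z (False # t) = (1 - q z) * trans_prob t0 z t"
    and IH: "\<And>w t. (\<And>z. z \<in> Z \<Longrightarrow> 0 \<le> w z) \<Longrightarrow> 0 < w z \<Longrightarrow> t \<in> {t0, t1} \<Longrightarrow> kl Z t w z
      = (\<Sum>l\<in>paths t. trans_prob t z l * ln (trans_prob t z l * (\<Sum>z\<in>Z. w z) / (\<Sum>z\<in>Z. w z * trans_prob t z l)))"
  shows "kl_node Z q (kl Z t0) (kl Z t1) w z
    = (\<Sum>l\<in>T. \<tau> z l * ln (\<tau> z l * (\<Sum>z\<in>Z. w z) / (\<Sum>z\<in>Z. w z * \<tau> z l)))"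
proof -
  have W: "(\<Sum>z\<in>Z. w z) \<noteq> 0" using sum_pos_of_mem[of Z w z] Z w by auto
  have k1: "q z * kl Z t1 (\<lambda>z. w z * q z) z = q z * (\<Sum>l\<in>paths t1. trans_prob t1 z l
      * ln (trans_prob t1 z l * (\<Sum>z\<in>Z. w z * q z) / (\<Sum>z\<in>Z. w z * q z * trans_prob t1 z l)))"
    using q(1)[of z] w by (cases "q z = 0") (auto simp: q less_le intro!: IH)
  have k0: "(1 - q z) * kl Z t0 (\<lambda>z. w z * (1 - q z)) z = (1 - q z) * (\<Sum>l\<in>paths t0. trans_prob t0 z l
      * ln (trans_prob t0 z l * (\<Sum>z\<in>Z. w z * (1 - q z)) / (\<Sum>z\<in>Z. w z * (1 - q z) * trans_prob t0 z l)))"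
    using q(2)[of z] w by (cases "q z = 1") (auto simp: q less_le intro!: IH)
  have 1: "q z * (ln (q z / avg Z w q) + kl Z t1 (\<lambda>z. w z * q z) z)
     = (\<Sum>t\<in>paths t1. \<tau> z (True # t) * ln (\<tau> z (True # t) * (\<Sum>z\<in>Z. w z) / (\<Sum>z\<in>Z. w z * \<tau> z (True # t))))"
    unfolding \<tau> distrib_left[of "q z"] k1 using Z w q
    by (subst branch_chain) (auto simp: sum_trans_prob distrib_left)
  have 0: "(1 - q z) * (ln ((1 - q z) / (1 - avg Z w q)) + kl Z t0 (\<lambda>z. w z * (1 - q z)) z)
     = (\<Sum>t\<in>paths t0. \<tau> z (False # t) * ln (\<tau> z (False # t) * (\<Sum>z\<in>Z. w z) / (\<Sum>z\<in>Z. w z * \<tau> z (False # t))))"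
    unfolding \<tau> distrib_left[of "1 - q z"] k0 one_minus_avg[OF W] using Z w q
    by (subst branch_chain[where r = "\<lambda>z. 1 - q z"]) (auto simp: sum_trans_prob distrib_left)
  show ?thesis
    unfolding T sum_paths_node kl_node_def 0 1 ..
qed

text \<open>The right side is the divergence, in nats, of the transcript law on input
  \<open>z\<close> from the \<open>w\<close>-average law; the recursion defining \<open>kl\<close>
  is its chain rule.\<close>

lemma kl_chain:
  assumes "finite Z" "z \<in> Z" "\<And>z. z \<in> Z \<Longrightarrow> 0 \<le> w z" "0 < w z"
  shows "kl Z P w z = (\<Sum>t\<in>paths P. trans_prob P z t
    * ln (trans_prob P z t * (\<Sum>z\<in>Z. w z) / (\<Sum>z\<in>Z. w z * trans_prob P z t)))"
  using assms(3,4)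
proof (induction P arbitrary: w)
  case (Leaf b)
  have "0 < (\<Sum>z\<in>Z. w z)" using sum_pos_of_mem[of Z w z] assms(1,2) Leaf by auto
  then show ?case by simp
next
  case (ANode p t0 t1)
  show ?case
    unfolding kl.simps
    by (rule kl_node_chain[where ?t0.0 = t0 and ?t1.0 = t1])
       (use assms ANode in \<open>auto simp: pmf_bind_bernoulli_Cons\<close>)
next
  case (BNode p t0 t1)
  show ?case
    unfolding kl.simps
    by (rule kl_node_chain[where ?t0.0 = t0 and ?t1.0 = t1])
       (use assms BNode in \<open>auto simp: pmf_bind_bernoulli_Cons\<close>)
qed

section \<open>Information and success probability as averages over the inputs\<close>

lemma pmf_joint: "pmf (joint P mu) (t, z) = pmf mu z * trans_prob P z t"
proof -
  have "pmf (map_pmf (\<lambda>t. (t, z')) (transcript P (fst z') (snd z'))) (t, z)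
      = indicator {z} z' * trans_prob P z t" for z'
  proof (cases "z' = z")
    case True
    then show ?thesis by (simp add: pmf_map_inj'[of "\<lambda>t. (t, z)" _ t, simplified] inj_def)
  qed (auto simp: pmf_eq_0_set_pmf)
  then show ?thesis
    by (simp add: joint_def case_prod_unfold pmf_bind measure_pmf_single)
qed

lemma map_snd_joint: "map_pmf snd (joint P mu) = mu"
  by (simp add: joint_def map_bind_pmf case_prod_unfold map_pmf_comp bind_return_pmf')

lemma pmf_map_fst_joint:
  assumes "finite Z" "set_pmf mu \<subseteq> Z"
  shows "pmf (map_pmf fst (joint P mu)) t = (\<Sum>z\<in>Z. pmf mu z * trans_prob P z t)"
proof -
  have "map_pmf fst (joint P mu) = bind_pmf mu (\<lambda>z. transcript P (fst z) (snd z))"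
    by (simp add: joint_def map_bind_pmf case_prod_unfold map_pmf_comp)
  then show ?thesis
    using assms by (simp add: pmf_bind integral_measure_pmf[of Z] subsetD)
qed

text \<open>Mutual information is the average divergence of the conditional law from the marginal.
  The factor \<open>ln 2\<close> converts bits to nats.\<close>

lemma ext_info_eq:
  assumes Z: "finite Z" "set_pmf mu \<subseteq> Z"
  shows "ext_info P mu * ln 2 = (\<Sum>z\<in>Z. pmf mu z * kl Z P (pmf mu) z)"
proof -
  let ?J = "joint P mu"
  define F where "F = (\<lambda>t z. pmf ?J (t, z) *
      ln (pmf ?J (t, z) / (pmf (map_pmf fst ?J) t * pmf mu z)))"
  have sub: "set_pmf ?J \<subseteq> paths P \<times> Z"
    using Z(2) set_transcript[of P] by (fastforce simp: joint_def)
  have sum1: "(\<Sum>z\<in>Z. pmf mu z) = 1" using Z by (rule sum_pmf_eq_1)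
  have "ext_info P mu * ln 2 = (\<Sum>(t, z)\<in>set_pmf ?J. F t z)"
    by (simp add: ext_info_def mutual_info_def log_def sum_divide_distrib[symmetric]
        F_def map_snd_joint case_prod_unfold)
  also have "\<dots> = (\<Sum>(t, z)\<in>paths P \<times> Z. F t z)"
    using Z sub by (intro sum.mono_neutral_left) (auto simp: F_def set_pmf_eq)
  also have "\<dots> = (\<Sum>z\<in>Z. \<Sum>t\<in>paths P. F t z)"
    by (simp add: sum.cartesian_product[symmetric] sum.swap[of _ Z])
  also have "\<dots> = (\<Sum>z\<in>Z. pmf mu z * kl Z P (pmf mu) z)"
  proof (rule sum.cong[OF refl])
    fix z assume z: "z \<in> Z"
    show "(\<Sum>t\<in>paths P. F t z) = pmf mu z * kl Z P (pmf mu) z"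
    proof (cases "pmf mu z = 0")
      case False
      then have "0 < pmf mu z" by (simp add: less_le)
      then show ?thesis
        using Z z sum1 False
        by (simp add: kl_chain F_def pmf_joint pmf_map_fst_joint sum_distrib_left mult.assoc)
    qed (simp add: F_def pmf_joint)
  qed
  finally show ?thesis .
qed

lemma prob_joint_eq:
  assumes "finite Z" "set_pmf mu \<subseteq> Z"
  shows "measure_pmf.prob (joint P mu) {(t, (x, y)). proto_output P t = f x y}
    = (\<Sum>z\<in>Z. pmf mu z * accept P (f (fst z) (snd z)) (fst z) (snd z))"
proof -
  have "measure_pmf.prob (joint P mu) {(t, (x, y)). proto_output P t = f x y}
     = measure_pmf.expectation mu (\<lambda>z. accept P (f (fst z) (snd z)) (fst z) (snd z))"
    by (simp add: prob_eq_pmf_map joint_def map_bind_pmf pmf_bind case_prod_unfold accept_def map_pmf_comp)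
  then show ?thesis
    using assms by (simp add: integral_measure_pmf[of Z] subsetD)
qed

subsection \<open>Zero information\<close>

text \<open>Zero divergence makes the bit probability the constant \<open>s\<close> on the support
  of \<open>w\<close>. The children then carry the weights \<open>s * w\<close> and
  \<open>(1 - s) * w\<close>, and their bounds \<open>s * m\<close> and \<open>(1 - s) * m\<close>
  add up to \<open>m\<close>.\<close>

lemma accept_bound_node:
  assumes Z: "finite Z" and w: "\<And>z. z \<in> Z \<Longrightarrow> 0 \<le> w z"
    and q: "\<And>z. 0 \<le> q z" "\<And>z. q z \<le> 1"
    and kl0: "\<And>z. z \<in> Z \<Longrightarrow> 0 < w z \<Longrightarrow> kl_node Z q (kl Z t0) (kl Z t1) w z = 0"
    and m: "\<And>c. (\<Sum>z\<in>Z. w z * of_bool (F z = c)) \<le> m"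
    and IH: "\<And>w m t. (\<And>z. z \<in> Z \<Longrightarrow> 0 \<le> w z) \<Longrightarrow>
        (\<And>z. z \<in> Z \<Longrightarrow> 0 < w z \<Longrightarrow> kl Z t w z = 0) \<Longrightarrow>
        (\<And>c. (\<Sum>z\<in>Z. w z * of_bool (F z = c)) \<le> m) \<Longrightarrow> t \<in> {t0, t1} \<Longrightarrow>
        (\<Sum>z\<in>Z. w z * accept t (F z) (fst z) (snd z)) \<le> m"
  shows "(\<Sum>z\<in>Z. w z * (q z * accept t1 (F z) (fst z) (snd z) + (1 - q z) * accept t0 (F z) (fst z) (snd z))) \<le> m"
proof -
  define s where "s = avg Z w q"
  have s: "0 \<le> s" "s \<le> 1" using avg_bounds[of Z w q] w q by (auto simp: s_def)
  have K: "q z = s" "q z < 1 \<Longrightarrow> kl Z t0 (\<lambda>z. w z * (1 - q z)) z = 0"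
     "0 < q z \<Longrightarrow> kl Z t1 (\<lambda>z. w z * q z) z = 0" if "z \<in> Z" "0 < w z" for z
  proof -
    have "q z < 1 \<Longrightarrow> 0 \<le> kl Z t0 (\<lambda>z. w z * (1 - q z)) z" "0 < q z \<Longrightarrow> 0 \<le> kl Z t1 (\<lambda>z. w z * q z) z"
      using Z w q that by (auto intro!: kl_nonneg)
    note kl_node_nonneg(2-4)[where Z = Z and z = z and w = w and q = q and ?k0.0 = "kl Z t0" and ?k1.0 = "kl Z t1",
      OF Z that(1) w that(2) q this]
    then show "q z = s" "q z < 1 \<Longrightarrow> kl Z t0 (\<lambda>z. w z * (1 - q z)) z = 0"
        "0 < q z \<Longrightarrow> kl Z t1 (\<lambda>z. w z * q z) z = 0"
      using kl0[OF that] by (auto simp: s_def)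
  qed
  have ws: "w z * q z = s * w z" "w z * (1 - q z) = (1 - s) * w z" if "z \<in> Z" for z
    using K(1)[OF that] w[OF that] by (cases "w z = 0"; simp)+
  have "(\<Sum>z\<in>Z. (w z * q z) * accept t1 (F z) (fst z) (snd z)) \<le> s * m"
  proof (rule IH)
    show "(\<Sum>z\<in>Z. w z * q z * of_bool (F z = c)) \<le> s * m" for c
      using mult_left_mono[OF m[of c] s(1)] by (simp add: ws sum_distrib_left mult.assoc)
    show "kl Z t1 (\<lambda>z. w z * q z) z = 0" if "z \<in> Z" "0 < w z * q z" for z
      using that w[of z] q(1)[of z] K(3)[of z] by (auto simp: zero_less_mult_iff)
  qed (use w q in auto)
  moreover have "(\<Sum>z\<in>Z. (w z * (1 - q z)) * accept t0 (F z) (fst z) (snd z)) \<le> (1 - s) * m"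
  proof (rule IH)
    show "(\<Sum>z\<in>Z. w z * (1 - q z) * of_bool (F z = c)) \<le> (1 - s) * m" for c
      using mult_left_mono[OF m[of c], of "1 - s"] s by (simp add: ws sum_distrib_left mult.assoc)
    show "kl Z t0 (\<lambda>z. w z * (1 - q z)) z = 0" if "z \<in> Z" "0 < w z * (1 - q z)" for z
      using that w[of z] q(2)[of z] K(2)[of z] by (auto simp: zero_less_mult_iff)
  qed (use w q in auto)
  ultimately have "(\<Sum>z\<in>Z. (w z * q z) * accept t1 (F z) (fst z) (snd z))
      + (\<Sum>z\<in>Z. (w z * (1 - q z)) * accept t0 (F z) (fst z) (snd z)) \<le> s * m + (1 - s) * m"
    by (rule add_mono)
  then show ?thesis
    by (simp add: sum.distrib[symmetric] algebra_simps)
qed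

text \<open>Without information the output is independent of the input, so guessing cannot beat the
  heavier value of \<open>F\<close>.\<close>

lemma accept_bound_of_kl_zero:
  assumes "finite Z" and "\<And>z. z \<in> Z \<Longrightarrow> 0 \<le> w z"
    and "\<And>z. z \<in> Z \<Longrightarrow> 0 < w z \<Longrightarrow> kl Z P w z = 0"
    and "\<And>c. (\<Sum>z\<in>Z. w z * of_bool (F z = c)) \<le> m"
  shows "(\<Sum>z\<in>Z. w z * accept P (F z) (fst z) (snd z)) \<le> m"
  using assms(2-)
proof (induction P arbitrary: w m)
  case (Leaf b)
  show ?case using Leaf(3)[of b] by (simp add: eq_commute)
next
  case (ANode p t0 t1)
  show ?case
    unfolding accept_ANode
    by (rule accept_bound_node[where q = "\<lambda>z. clamp (p (fst z))"])
       (use assms(1) ANode in auto)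
next
  case (BNode p t0 t1)
  show ?case
    unfolding accept_BNode
    by (rule accept_bound_node[where q = "\<lambda>z. clamp (p (snd z))"])
       (use assms(1) BNode in auto)
qed

subsection \<open>Success probability under relative discrepancy\<close>

context rectangle_bound
begin

text \<open>The clipped protocol starts with all ratios equal to 1, where \<open>psi\<close>
  vanishes. Its error is bounded by discrepancy, and averaging the maximal inequality over
  \<open>mu\<close> bounds the advantage of \<open>P\<close> over it by the divergence divided by
  \<open>psi K\<close>.\<close>

lemma success_le:
  assumes mu: "\<And>x y. 0 \<le> mu x y" "(\<Sum>x\<in>X. \<Sum>y\<in>Y. mu x y) = 1"
    and rho: "(\<Sum>x\<in>X. \<Sum>y\<in>Y. rho x y) = 1"
    and psi: "0 < psi K"
  shows "(\<Sum>z\<in>X \<times> Y. mu (fst z) (snd z) * accept P (f (fst z) (snd z)) (fst z) (snd z))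
    \<le> 1 - kappa * (1 - delta * K\<^sup>2)
      + (\<Sum>z\<in>X \<times> Y. mu (fst z) (snd z) * kl (X \<times> Y) P (\<lambda>z. mu (fst z) (snd z)) z) / psi K"
proof -
  let ?Z = "X \<times> Y" and ?w = "\<lambda>z. mu (fst z) (snd z)"
  let ?acc = "\<lambda>P z. accept P (f (fst z) (snd z)) (fst z) (snd z)"
  let ?one = "\<lambda>_. 1 :: real"
  have "\<exists>P'. clipped ?w ?one ?one ?one ?one 1 1 P P'"
    using mu K by (intro ex_clipped) auto
  then obtain P' where P': "clipped ?w ?one ?one ?one ?one 1 1 P P'" ..
  have w1: "(\<Sum>z\<in>?Z. ?w z) = 1"
    using mu(2) by (simp add: sum.cartesian_product case_prod_unfold)
  have "kappa * (1 - delta * K\<^sup>2) \<le> error ?one ?one P'"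
    using P' rho by (simp add: clipped_def mass_def power2_eq_square mult.assoc)
  also have "\<dots> = (\<Sum>z\<in>?Z. ?w z * (1 - ?acc P' z))"
    by (simp add: error_def sum.cartesian_product case_prod_unfold accept_Not)
  also have "\<dots> = 1 - (\<Sum>z\<in>?Z. ?w z * ?acc P' z)"
    using w1 by (simp add: right_diff_distrib sum_subtractf)
  finally have err: "(\<Sum>z\<in>?Z. ?w z * ?acc P' z) \<le> 1 - kappa * (1 - delta * K\<^sup>2)"
    by simp
  have "?w z * (psi K * (?acc P z - ?acc P' z)) \<le> ?w z * kl ?Z P ?w z" if "z \<in> ?Z" for z
  proof (cases "?w z = 0")
    case False
    then have "0 < ?w z" using mu(1)[of "fst z" "snd z"] by simp
    then have "psi K * (?acc P z - ?acc P' z) \<le> kl ?Z P ?w z"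
      using P' that by (auto simp: clipped_def psi_def)
    then show ?thesis by (rule mult_left_mono) (rule mu(1))
  qed simp
  then have "(\<Sum>z\<in>?Z. ?w z * (psi K * (?acc P z - ?acc P' z))) \<le> (\<Sum>z\<in>?Z. ?w z * kl ?Z P ?w z)"
    by (rule sum_mono)
  also have "(\<Sum>z\<in>?Z. ?w z * (psi K * (?acc P z - ?acc P' z)))
      = ((\<Sum>z\<in>?Z. ?w z * ?acc P z) - (\<Sum>z\<in>?Z. ?w z * ?acc P' z)) * psi K"
    unfolding sum_subtractf[symmetric] sum_distrib_right by (simp add: algebra_simps)
  finally have "(\<Sum>z\<in>?Z. ?w z * ?acc P z) - (\<Sum>z\<in>?Z. ?w z * ?acc P' z)
      \<le> (\<Sum>z\<in>?Z. ?w z * kl ?Z P ?w z) / psi K"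
    using psi by (simp add: pos_le_divide_eq)
  with err show ?thesis by linarith
qed

end

section \<open>Choice of the clipping level and the final estimate\<close>

lemma finite_cube: "finite (cube n)"
  using finite_lists_length_eq[of "UNIV :: bool set" n] by (simp add: cube_def)

text \<open>Here \<open>delta * K ^ 2\<close> is the square root of \<open>delta\<close>, that is
  \<open>exp (- D / 2)\<close>, and \<open>psi K\<close> is at least
  \<open>D / 4 - 1\<close>.\<close>

lemma clip_level_estimate:
  fixes D :: real
  assumes "0 < delta" "D = ln (1 / delta)" "2000 < D" "K = exp (D / 4)"
  shows "delta * K\<^sup>2 \<le> 2 / D" "D / 5 \<le> psi K"
proof -
  have "delta = exp (- D)"
    using assms by (simp add: ln_div exp_ln)
  then have "delta * K\<^sup>2 = exp (- (D / 2))"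
    using assms(4) by (simp add: power2_eq_square exp_add[symmetric])
  also have "\<dots> = 1 / exp (D / 2)"
    by (simp only: exp_minus inverse_eq_divide)
  also have "\<dots> \<le> 1 / (D / 2)"
  proof (rule frac_le)
    show "D / 2 \<le> exp (D / 2)" using exp_ge_add_one_self[of "D / 2"] by linarith
  qed (use assms(3) in auto)
  finally show "delta * K\<^sup>2 \<le> 2 / D" by simp
  have "D / 5 \<le> D / 4 - 1" using assms(3) by simp
  also have "\<dots> \<le> psi K"
    using assms(4) by (simp add: psi_def)
  finally show "D / 5 \<le> psi K" .
qed

theorem theorem3p3:
  fixes M :: nat and n :: nat and delta eps :: real
    and mu :: "(bool list \<times> bool list) pmf"
    and f :: "bool list \<Rightarrow> bool list \<Rightarrow> bool"
    and P :: "bool list proto"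
  assumes "delta > 0" and "delta < 1" and "eps > 0"
    and "set_pmf mu \<subseteq> cube n \<times> cube n"
    and "rel_disc n f mu eps delta"
    and "ext_info P mu \<le> real M"
  shows "measure_pmf.prob (joint P mu) {(t, (x, y)). proto_output P t = f x y}
           \<le> 1/2 + 2000 * max eps (real M / log 2 (1 / delta))"
proof -
  let ?Z = "cube n \<times> cube n"
  let ?S = "measure_pmf.prob (joint P mu) {(t, (x, y)). proto_output P t = f x y}"
  let ?kl = "\<lambda>z. kl ?Z P (pmf mu) z"
  define c where "c = real M / log 2 (1 / delta)"
  have Z: "finite ?Z" by (simp add: finite_cube)
  have S: "?S = (\<Sum>z\<in>?Z. pmf mu z * accept P (f (fst z) (snd z)) (fst z) (snd z))"
    using prob_joint_eq[OF Z assms(4)] .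
  have info: "(\<Sum>z\<in>?Z. pmf mu z * ?kl z) \<le> real M * ln 2"
    using ext_info_eq[OF Z assms(4)] assms(6) by (metis mult_right_mono ln_ge_zero one_le_numeral)
  have mu1: "(\<Sum>z\<in>?Z. pmf mu z) = 1"
    using Z assms(4) by (rule sum_pmf_eq_1)
  obtain rho where rho: "set_pmf rho \<subseteq> ?Z"
    and disc: "\<And>A B. A \<subseteq> cube n \<Longrightarrow> B \<subseteq> cube n \<Longrightarrow> delta \<le> measure_pmf.prob rho (A \<times> B) \<Longrightarrow>
      (1/2 - eps) * measure_pmf.prob rho (A \<times> B) \<le> measure_pmf.prob mu ((A \<times> B) \<inter> {(x, y). \<not> f x y}) \<and>
      (1/2 - eps) * measure_pmf.prob rho (A \<times> B) \<le> measure_pmf.prob mu ((A \<times> B) \<inter> {(x, y). f x y})"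
    using assms(5) unfolding rel_disc_def by blast
  have rho1: "(\<Sum>z\<in>?Z. pmf rho z) = 1"
    using Z rho by (rule sum_pmf_eq_1)
  have prob_rho: "measure_pmf.prob rho (A \<times> B) = (\<Sum>x\<in>A. \<Sum>y\<in>B. pmf rho (x, y))"
    if "A \<subseteq> cube n" "B \<subseteq> cube n" for A B
    using that finite_cube[of n]
    by (simp add: measure_measure_pmf_finite finite_subset sum.cartesian_product)
  have prob_mu: "measure_pmf.prob mu ((A \<times> B) \<inter> {(x, y). f x y = c}) = (\<Sum>x\<in>A. \<Sum>y\<in>B. pmf mu (x, y) * of_bool (f x y = c))"
    if "A \<subseteq> cube n" "B \<subseteq> cube n" for A B c
  proof -
    have AB: "finite (A \<times> B)" using that finite_cube[of n] by (auto intro: finite_subset)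
    have "measure_pmf.prob mu ((A \<times> B) \<inter> {(x, y). f x y = c}) = sum (pmf mu) ((A \<times> B) \<inter> {(x, y). f x y = c})"
      using AB by (intro measure_measure_pmf_finite) auto
    also have "\<dots> = (\<Sum>z\<in>A \<times> B. pmf mu z * of_bool (f (fst z) (snd z) = c))"
      using AB by (intro sum.mono_neutral_cong_left) auto
    finally show ?thesis
      by (simp add: sum.cartesian_product case_prod_unfold)
  qed
  have rect: "(1/2 - eps) * (\<Sum>x\<in>A. \<Sum>y\<in>B. pmf rho (x, y)) \<le> (\<Sum>x\<in>A. \<Sum>y\<in>B. pmf mu (x, y) * of_bool (f x y = c))"
    if "A \<subseteq> cube n" "B \<subseteq> cube n" "delta \<le> (\<Sum>x\<in>A. \<Sum>y\<in>B. pmf rho (x, y))" for A B c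
    using disc[OF that(1,2)] that(3) prob_rho[OF that(1,2)] prob_mu[OF that(1,2), of c]
    by (cases c) auto
  \<comment> \<open>From \<open>1/4000\<close> on the claimed bound is at least 1. Below it,
    \<open>M = 0\<close> is separate because the loss \<open>delta * K ^ 2\<close> cannot be charged
    to \<open>c\<close>.\<close>
  consider "1 / 4000 \<le> max eps c" | "eps < 1/4000" "M = 0" | "eps < 1/4000" "c < 1/4000" "0 < M"
    by force
  then have "?S \<le> 1/2 + 2000 * max eps c"
  proof cases
    case 1
    have "?S \<le> 1" by (rule measure_pmf.prob_le_1)
    also have "\<dots> \<le> 1/2 + 2000 * max eps c" using 1 by simp
    finally show ?thesis .
  next
    case 2
    \<comment> \<open>The whole cube has \<open>rho\<close>-probability 1, so each value of
      \<open>f\<close> has \<open>mu\<close>-weight at least \<open>1/2 - eps\<close>, and the other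
      value the complement.\<close>
    have half: "(\<Sum>z\<in>?Z. pmf mu z * of_bool (f (fst z) (snd z) = d)) \<le> 1/2 + eps" for d
    proof -
      have "1/2 - eps \<le> (\<Sum>z\<in>?Z. pmf mu z * of_bool (f (fst z) (snd z) = (\<not> d)))"
        using rect[of "cube n" "cube n" "\<not> d"] rho1 assms(2)
        by (simp add: sum.cartesian_product case_prod_unfold)
      moreover have "(\<Sum>z\<in>?Z. pmf mu z * of_bool (f (fst z) (snd z) = d))
          + (\<Sum>z\<in>?Z. pmf mu z * of_bool (f (fst z) (snd z) = (\<not> d))) = (\<Sum>z\<in>?Z. pmf mu z)"
        unfolding sum.distrib[symmetric] by (intro sum.cong) auto
      ultimately show ?thesis using mu1 by linarith
    qed
    have nn: "0 \<le> pmf mu z * ?kl z" if "z \<in> ?Z" for z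
      using kl_nonneg[OF Z that, of "pmf mu" P] by (cases "pmf mu z = 0") (auto simp: less_le)
    have "(\<Sum>z\<in>?Z. pmf mu z * ?kl z) = 0"
      using info 2 by (intro antisym sum_nonneg nn) auto
    moreover have "(\<Sum>z\<in>?Z. pmf mu z * ?kl z) = 0 \<longleftrightarrow> (\<forall>z\<in>?Z. pmf mu z * ?kl z = 0)"
      by (rule sum_nonneg_eq_0_iff[OF Z]) (rule nn)
    ultimately have kl0: "?kl z = 0" if "z \<in> ?Z" "0 < pmf mu z" for z
      using that by fastforce
    have "?S \<le> 1/2 + eps"
      unfolding S by (rule accept_bound_of_kl_zero[OF Z]) (use kl0 half in simp_all)
    then show ?thesis using assms(3) by (simp add: max_def)
  next
    case 3
    define D where "D = ln (1 / delta)"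
    define K where "K = exp (D / 4)"
    have D: "0 < D" using assms(1,2) by (simp add: D_def)
    have c: "c = real M * ln 2 / D" by (simp add: c_def D_def log_def)
    have ln2: "1 / 2 \<le> ln (2::real)" using ln_ge_one_minus_inverse[of 2] by simp
    have Mln: "1 / 2 \<le> real M * ln 2"
      using mult_mono[OF _ ln2, of 1 "real M"] 3 by simp
    \<comment> \<open>From \<open>c < 1/4000\<close> it follows that \<open>D\<close> exceeds
      \<open>4000 * M * ln 2\<close>, and \<open>M * ln 2\<close> is at least
      \<open>1/2\<close>.\<close>
    have "2000 < D"
      using 3(2) Mln D unfolding c by (simp add: divide_less_eq)
    note est = clip_level_estimate[OF assms(1) D_def this K_def]
    have psi: "0 < psi K" using est(2) D by linarith
    have nn: "0 \<le> (\<Sum>x\<in>A. \<Sum>y\<in>B. pmf mu (x, y) * of_bool (f x y = d))" for A B d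
      by (intro sum_nonneg) auto
    interpret rectangle_bound "cube n" "cube n" "\<lambda>x y. pmf mu (x, y)" "\<lambda>x y. pmf rho (x, y)" f "1/2 - eps" delta K
    proof
      show "1 \<le> K" using D by (simp add: K_def)
      show "(1/2 - eps) * ((\<Sum>x\<in>A. \<Sum>y\<in>B. pmf rho (x, y)) - delta) \<le> (\<Sum>x\<in>A. \<Sum>y\<in>B. pmf mu (x, y) * of_bool (f x y = d))"
        if "A \<subseteq> cube n" "B \<subseteq> cube n" for A B d
      proof (cases "delta \<le> (\<Sum>x\<in>A. \<Sum>y\<in>B. pmf rho (x, y))")
        case True
        have "(1/2 - eps) * ((\<Sum>x\<in>A. \<Sum>y\<in>B. pmf rho (x, y)) - delta) \<le> (1/2 - eps) * (\<Sum>x\<in>A. \<Sum>y\<in>B. pmf rho (x, y))"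
          using 3 assms(1) by (intro mult_left_mono) auto
        then show ?thesis using rect[OF that True, of d] by linarith
      next
        case False
        then have "(1/2 - eps) * ((\<Sum>x\<in>A. \<Sum>y\<in>B. pmf rho (x, y)) - delta) \<le> 0"
          using 3 by (intro mult_nonneg_nonpos) auto
        then show ?thesis using nn[where A = A and B = B and d = d] by linarith
      qed
    qed (simp_all add: finite_cube)
    have "?S \<le> 1 - (1/2 - eps) * (1 - delta * K\<^sup>2) + (\<Sum>z\<in>?Z. pmf mu z * ?kl z) / psi K"
      unfolding S using success_le[of P] mu1 rho1 psi
      by (simp add: sum.cartesian_product case_prod_unfold)
    also have "(\<Sum>z\<in>?Z. pmf mu z * ?kl z) / psi K \<le> (real M * ln 2) / (D / 5)"
      using info est(2) D Mln by (intro frac_le) auto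
    also have "(real M * ln 2) / (D / 5) = 5 * c" by (simp add: c)
    also have "1 - (1/2 - eps) * (1 - delta * K\<^sup>2) \<le> 1/2 + eps + delta * K\<^sup>2"
    proof -
      have "0 \<le> (1/2 + eps) * (delta * K\<^sup>2)" using assms(1,3) by (intro mult_nonneg_nonneg) auto
      then show ?thesis by (simp add: algebra_simps)
    qed
    \<comment> \<open>The loss is at most \<open>2 / D\<close>, and \<open>M * ln 2\<close> at least
      \<open>1/2\<close> turns this into a multiple of \<open>c\<close>. The total excess
      \<open>eps + 9 * c\<close> is far below the allowed one.\<close>
    also have "delta * K\<^sup>2 \<le> 4 * c"
      using est(1) Mln D by (simp add: c field_simps)
    finally have "?S \<le> 1/2 + eps + 4 * c + 5 * c" by simp
    moreover have "0 \<le> c" using D Mln by (simp add: c)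
    ultimately show ?thesis using assms(3) by (simp add: max_def)
  qed
  then show ?thesis by (simp add: c_def)
qed

end
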